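(* Let $1\le k<n$ and consider the system $z'=H(z,\varepsilon)=N(z)f(z)+\varepsilon G(z,\varepsilon)$, $z\in\mathbb{R}^n$, with sufficiently smooth $N$ (an $n\times(n-k)$ matrix function), $f:\mathbb{R}^n\to\mathbb{R}^{n-k}$ and $G$ (with values in $\mathbb{R}^n$). Suppose that $S=\{f=0\}$ is a $k$-dimensional differentiable manifold, that $N(z)$ has full column rank for all $z\in S$, and that $S$ is normally hyperbolic and attracting. Work locally in coordinates $z=(x,y)\in\mathbb{R}^k\times\mathbb{R}^{n-k}$ in which $S$ is a graph $y=h_0(x)$ with $D_yf$ invertible along $S$. Initialize the two-step CSP method with $$A^{(0)}=\begin{pmatrix}N & (Df^{\top})^{\perp}\end{pmatrix},\qquad B^{(0)}=\begin{pmatrix}(Df\,N)^{-1}Df\\ \big((N^{\perp})^{\top}(Df^{\top})^{\perp}\big)^{-1}(N^{\perp})^{\top}\end{pmatrix}.$$ Let $y=\psi^{(0)}(x,\varepsilon)$ be the local graph (near $S$, for small $\varepsilon$) of the CSP manifold $\mathcal{K}^{(0)}$ of order $0$, with asymptotic expansion whose leading-order coefficient is $h_0(x)$. Let the CSP manifold $\mathcal{K}^{(1)}$ of order $1$, obtained after one two-step CSP update, have the local graph form $y=\psi^{(1)}(x,\varepsilon)=\psi^{(1)}_0(x)+\varepsilon\,\psi^{(1)}_1(x)+\mathcal{O}(\varepsilon^2)$, where $\psi^{(1)}_0=h_0$, i.e. $f(x,\psi^{(1)}_0(x))=0$. Then $$\psi^{(1)}_1=-(D_yf_0)^{-1}(Df_0\,N_0)^{-1}(Df_0\,G_0),$$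 where $D_yf_0$, $Df_0$, $N_0$ denote $D_yf$, $Df$, $N$ evaluated at $(x,h_0(x))$, and $G_0=G(x,h_0(x),0)$.
   Context: $S$ is normally hyperbolic and attracting if for $z\in S$ the $n-k$ nontrivial eigenvalues of $DH(z,0)=N(z)Df(z)$ (those remaining after the $k$ trivial zero eigenvalues corresponding to $T_zS$) are bounded away from the imaginary axis and have negative real part. All constructions are carried out in a neighborhood of $S$ where the inverses below exist. $P^{\perp}$ denotes a matrix, chosen depending smoothly on the point, whose columns form a basis of the orthogonal complement of the column space of $P$. $B^{(0)}$ is the inverse of $A^{(0)}$. For a smooth $n\times m$ matrix function $X$ and smooth vector field $H$, $[X,H]$ is the $n\times m$ matrix with $i$th column $(DH)X_i-(DX_i)H$, where $X_i$ is the $i$th column of $X$. CSP method: given $A^{(j)}=(A_f^{(j)}\ A_s^{(j)})$ (blocks of sizes $n\times(n-k)$ and $n\times k$) with inverse $B^{(j)}=\begin{pmatrix}B^{(j)}_{s\perp}\\ B^{(j)}_{f\perp}\end{pmatrix}$ (blocks of sizes $(n-k)\times n$ and $k\times n$), set $$\Lambda^{(j)}=B^{(j)}[A^{(j)},H]=\begin{pmatrix}\Lambda_{ff}^{(j)}&\Lambda_{fs}^{(j)}\\ \Lambda_{sf}^{(j)}&\Lambda_{ss}^{(j)}\end{pmatrix}=\begin{pmatrix}B^{(j)}_{s\perp}[A^{(j)}_f,H]&B^{(j)}_{s\perp}[A^{(j)}_s,H]\\ B^{(j)}_{f\perp}[A^{(j)}_f,H]&B^{(j)}_{f\perp}[A^{(j)}_s,H]\end{pmatrix},$$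 $\tilde U^{(j)}=(\Lambda_{ff}^{(j)})^{-1}\Lambda_{fs}^{(j)}$ and $\tilde L^{(j)}=\Lambda_{sf}^{(j)}(\Lambda_{ff}^{(j)})^{-1}$. With $U^{(j)}=\begin{pmatrix}0&\tilde U^{(j)}\\0&0\end{pmatrix}$ and $L^{(j)}=\begin{pmatrix}0&0\\ \tilde L^{(j)}&0\end{pmatrix}$, the two-step CSP update is $A^{(j+1)}=A^{(j)}(I-U^{(j)})(I+L^{(j)})$, $B^{(j+1)}=(I-L^{(j)})(I+U^{(j)})B^{(j)}$; in particular $B^{(j+1)}_{s\perp}=B^{(j)}_{s\perp}+\tilde U^{(j)}B^{(j)}_{f\perp}$. CSP manifolds: $\mathcal{K}^{(0)}=\{(x,y): B^{(0)}_{s\perp}(x,y,\varepsilon)H(x,y,\varepsilon)=0\}$, and for $j\ge1$, $\mathcal{K}^{(j)}=\{(x,y): B^{(j)}_{s\perp}(x,\psi^{(j-1)}(x,\varepsilon),\varepsilon)H(x,y,\varepsilon)=0\}$, where $y=\psi^{(j-1)}(x,\varepsilon)$ is a graph of $\mathcal{K}^{(j-1)}$. *)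

theory Defs
  imports "HOL-Analysis.Analysis"
begin

text \<open>
  The phase space R^n with n = k + (n - k) is \<open>real ^ ('k + 'm)\<close>, where
  \<open>k = CARD('k)\<close> and \<open>n - k = CARD('m)\<close>.  Types are nonempty, so \<open>1 \<le> k < n\<close> is automatic.
  Rows of \<open>A\<close> and columns of \<open>B\<close> are indexed by \<open>'k + 'm\<close> (slow coordinates \<open>x\<close>, then \<open>y\<close>);
  columns of \<open>A\<close> and rows of \<open>B\<close> by \<open>'m + 'k\<close> (fast block, then slow block).
\<close>

definition zjoin :: "real ^ 'k \<Rightarrow> real ^ 'm \<Rightarrow> real ^ ('k::finite + 'm::finite)" where
  "zjoin x y = (\<chi> i. case i of Inl a \<Rightarrow> x $ a | Inr b \<Rightarrow> y $ b)"

definition graph_over :: "(real ^ 'k) set \<Rightarrow> (real ^ 'k \<Rightarrow> real ^ 'm) \<Rightarrow> (real ^ ('k::finite + 'm::finite)) set" where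
  "graph_over X h = {zjoin x (h x) | x. x \<in> X}"

definition C1_on :: "('a::real_normed_vector \<Rightarrow> 'b::real_normed_vector) \<Rightarrow> 'a set \<Rightarrow> bool" where
  "C1_on F W \<longleftrightarrow>
     (\<exists>F'. (\<forall>x\<in>W. (F has_derivative blinfun_apply (F' x)) (at x)) \<and> continuous_on W F')"

text \<open>Differentiable submanifolds of dimension \<open>CARD('k)\<close>, by \<open>C\<^sup>1\<close> straightening charts of the ambient space.\<close>

definition differentiable_submanifold :: "(real ^ ('k::finite + 'm::finite)) set \<Rightarrow> bool" where
  "differentiable_submanifold S \<longleftrightarrow>
     (\<forall>p\<in>S. \<exists>V (\<phi> :: real ^ ('k + 'm) \<Rightarrow> real ^ ('k + 'm)) \<gamma>.
        open V \<and> p \<in> V \<and> open (\<phi> ` V) \<and> C1_on \<phi> V \<and> C1_on \<gamma> (\<phi> ` V) \<and>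
        (\<forall>z\<in>V. \<gamma> (\<phi> z) = z) \<and>
        \<phi> ` (S \<inter> V) = {w \<in> \<phi> ` V. \<forall>b. w $ Inr b = 0})"

text \<open>\<open>is_perp P Q\<close>: the columns of \<open>Q\<close> form a basis of the orthogonal complement of the column space of \<open>P\<close>.\<close>

definition is_perp :: "real ^ 'a ^ 'n \<Rightarrow> real ^ 'b ^ 'n \<Rightarrow> bool" where
  "is_perp P Q \<longleftrightarrow>
     inj (\<lambda>j. column j Q) \<and> independent (columns Q) \<and>
     span (columns Q) = (span (columns P))\<^sup>\<bottom>"

subsection \<open>Block matrices\<close>

definition hcat :: "real ^ 'a ^ 'n \<Rightarrow> real ^ 'b ^ 'n \<Rightarrow> real ^ ('a::finite + 'b::finite) ^ 'n" where
  "hcat P Q = (\<chi> i j. case j of Inl a \<Rightarrow> P $ i $ a | Inr b \<Rightarrow> Q $ i $ b)"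

definition vcat :: "real ^ 'n ^ 'a \<Rightarrow> real ^ 'n ^ 'b \<Rightarrow> real ^ 'n ^ ('a::finite + 'b::finite)" where
  "vcat P Q = (\<chi> i. case i of Inl a \<Rightarrow> P $ a | Inr b \<Rightarrow> Q $ b)"

definition left_cols :: "real ^ ('a::finite + 'b::finite) ^ 'n \<Rightarrow> real ^ 'a ^ 'n" where
  "left_cols M = (\<chi> i j. M $ i $ Inl j)"

definition right_cols :: "real ^ ('a::finite + 'b::finite) ^ 'n \<Rightarrow> real ^ 'b ^ 'n" where
  "right_cols M = (\<chi> i j. M $ i $ Inr j)"

definition top_rows :: "real ^ 'n ^ ('a::finite + 'b::finite) \<Rightarrow> real ^ 'n ^ 'a" where
  "top_rows M = (\<chi> i. M $ Inl i)"

definition bot_rows :: "real ^ 'n ^ ('a::finite + 'b::finite) \<Rightarrow> real ^ 'n ^ 'b" where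
  "bot_rows M = (\<chi> i. M $ Inr i)"

subsection \<open>The CSP method\<close>

text \<open>Column \<open>j\<close> of \<open>bracket X H\<close> is \<open>(DH) X\<^sub>j - (D X\<^sub>j) H\<close>.\<close>

definition bracket ::
  "(real ^ 'n \<Rightarrow> real ^ 'c ^ 'n) \<Rightarrow> (real ^ 'n \<Rightarrow> real ^ 'n) \<Rightarrow> real ^ 'n \<Rightarrow> real ^ 'c ^ 'n" where
  "bracket X H z =
     (\<chi> i j. (jacobian H (at z) *v column j (X z)
              - jacobian (\<lambda>w. column j (X w)) (at z) *v H z) $ i)"

type_synonym ('k, 'm) csp_basis = "real ^ ('k + 'm) \<Rightarrow> real ^ ('m + 'k) ^ ('k + 'm)"
type_synonym ('k, 'm) csp_dual = "real ^ ('k + 'm) \<Rightarrow> real ^ ('k + 'm) ^ ('m + 'k)"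

definition csp_Lambda ::
  "(real ^ ('k + 'm) \<Rightarrow> real ^ ('k + 'm)) \<Rightarrow> ('k::finite, 'm::finite) csp_basis \<Rightarrow> ('k, 'm) csp_dual
   \<Rightarrow> real ^ ('k + 'm) \<Rightarrow> real ^ ('m + 'k) ^ ('m + 'k)" where
  "csp_Lambda H A B z = B z ** bracket A H z"

definition Lambda_ff :: "real ^ ('m::finite + 'k::finite) ^ ('m + 'k) \<Rightarrow> real ^ 'm ^ 'm" where
  "Lambda_ff M = left_cols (top_rows M)"

definition Lambda_fs :: "real ^ ('m::finite + 'k::finite) ^ ('m + 'k) \<Rightarrow> real ^ 'k ^ 'm" where
  "Lambda_fs M = right_cols (top_rows M)"

definition Lambda_sf :: "real ^ ('m::finite + 'k::finite) ^ ('m + 'k) \<Rightarrow> real ^ 'm ^ 'k" where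
  "Lambda_sf M = left_cols (bot_rows M)"

definition csp_U :: "real ^ ('m::finite + 'k::finite) ^ ('m + 'k) \<Rightarrow> real ^ ('m + 'k) ^ ('m + 'k)" where
  "csp_U M = vcat (hcat 0 (matrix_inv (Lambda_ff M) ** Lambda_fs M)) 0"

definition csp_L :: "real ^ ('m::finite + 'k::finite) ^ ('m + 'k) \<Rightarrow> real ^ ('m + 'k) ^ ('m + 'k)" where
  "csp_L M = vcat 0 (hcat (Lambda_sf M ** matrix_inv (Lambda_ff M)) 0)"

definition csp_step ::
  "(real ^ ('k + 'm) \<Rightarrow> real ^ ('k + 'm))
   \<Rightarrow> ('k::finite, 'm::finite) csp_basis \<times> ('k, 'm) csp_dual
   \<Rightarrow> ('k, 'm) csp_basis \<times> ('k, 'm) csp_dual" where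
  "csp_step H = (\<lambda>(A, B).
     ((\<lambda>z. A z ** (mat 1 - csp_U (csp_Lambda H A B z)) ** (mat 1 + csp_L (csp_Lambda H A B z))),
      (\<lambda>z. (mat 1 - csp_L (csp_Lambda H A B z)) ** (mat 1 + csp_U (csp_Lambda H A B z)) ** B z)))"

definition csp ::
  "(real ^ ('k + 'm) \<Rightarrow> real ^ ('k + 'm))
   \<Rightarrow> ('k::finite, 'm::finite) csp_basis \<Rightarrow> ('k, 'm) csp_dual \<Rightarrow> nat
   \<Rightarrow> ('k, 'm) csp_basis \<times> ('k, 'm) csp_dual" where
  "csp H A\<^sub>0 B\<^sub>0 j = (csp_step H ^^ j) (A\<^sub>0, B\<^sub>0)"

definition csp_Bs ::
  "(real ^ ('k + 'm) \<Rightarrow> real ^ ('k + 'm))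
   \<Rightarrow> ('k::finite, 'm::finite) csp_basis \<Rightarrow> ('k, 'm) csp_dual \<Rightarrow> nat
   \<Rightarrow> real ^ ('k + 'm) \<Rightarrow> real ^ ('k + 'm) ^ 'm" where
  "csp_Bs H A\<^sub>0 B\<^sub>0 j z = top_rows (snd (csp H A\<^sub>0 B\<^sub>0 j) z)"

subsection \<open>The CSP manifolds, at a fixed value of the small parameter\<close>

definition csp_manifold_0 ::
  "(real ^ ('k + 'm)) set \<Rightarrow> (real ^ ('k + 'm) \<Rightarrow> real ^ ('k + 'm))
   \<Rightarrow> ('k::finite, 'm::finite) csp_basis \<Rightarrow> ('k, 'm) csp_dual \<Rightarrow> (real ^ ('k + 'm)) set" where
  "csp_manifold_0 \<Omega> H A\<^sub>0 B\<^sub>0 = {z \<in> \<Omega>. csp_Bs H A\<^sub>0 B\<^sub>0 0 z *v H z = 0}"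

text \<open>Order \<open>Suc j\<close>; \<open>\<psi>\<close> is the graph over \<open>X\<close> of the CSP manifold of order \<open>j\<close>.\<close>

definition csp_manifold_Suc ::
  "(real ^ ('k + 'm)) set \<Rightarrow> (real ^ 'k) set \<Rightarrow> (real ^ ('k + 'm) \<Rightarrow> real ^ ('k + 'm))
   \<Rightarrow> ('k::finite, 'm::finite) csp_basis \<Rightarrow> ('k, 'm) csp_dual \<Rightarrow> nat
   \<Rightarrow> (real ^ 'k \<Rightarrow> real ^ 'm) \<Rightarrow> (real ^ ('k + 'm)) set" where
  "csp_manifold_Suc \<Omega> X H A\<^sub>0 B\<^sub>0 j \<psi> =
     {zjoin x y | x y. x \<in> X \<and> zjoin x y \<in> \<Omega> \<and>
        csp_Bs H A\<^sub>0 B\<^sub>0 (Suc j) (zjoin x (\<psi> x)) *v H (zjoin x y) = 0}"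

text \<open>
  \<open>\<psi>\<close> is the local graph of the family \<open>K\<close>, near the piece \<open>y = h\<^sub>0 x\<close> of the critical
  manifold and for parameters \<open>0 < \<epsilon> < \<epsilon>\<^sub>0\<close>.
\<close>

definition local_graph ::
  "(real ^ 'k) set \<Rightarrow> (real ^ 'k \<Rightarrow> real ^ 'm) \<Rightarrow> real
   \<Rightarrow> (real \<Rightarrow> (real ^ ('k::finite + 'm::finite)) set) \<Rightarrow> (real ^ 'k \<Rightarrow> real \<Rightarrow> real ^ 'm) \<Rightarrow> bool" where
  "local_graph X h\<^sub>0 \<epsilon>\<^sub>0 K \<psi> \<longleftrightarrow>
     (\<exists>W. open W \<and> graph_over X h\<^sub>0 \<subseteq> W \<and>
       (\<forall>\<epsilon>. 0 < \<epsilon> \<and> \<epsilon> < \<epsilon>\<^sub>0 \<longrightarrow> K \<epsilon> \<inter> W = graph_over X (\<lambda>x. \<psi> x \<epsilon>)))"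

subsection \<open>The system and the initial basis\<close>

definition vfield ::
  "(real ^ 'n \<Rightarrow> real ^ 'm ^ 'n) \<Rightarrow> (real ^ 'n \<Rightarrow> real ^ 'm) \<Rightarrow> (real ^ 'n \<Rightarrow> real \<Rightarrow> real ^ 'n)
   \<Rightarrow> real \<Rightarrow> real ^ 'n \<Rightarrow> real ^ 'n" where
  "vfield N f G \<epsilon> z = N z *v f z + \<epsilon> *\<^sub>R G z \<epsilon>"

text \<open>\<open>P z\<close> stands for a choice of \<open>(Df\<^sup>T)\<^sup>\<bottom>\<close> and \<open>Q z\<close> for a choice of \<open>N\<^sup>\<bottom>\<close>.\<close>

definition init_A ::
  "(real ^ ('k + 'm) \<Rightarrow> real ^ 'm ^ ('k + 'm)) \<Rightarrow> (real ^ ('k + 'm) \<Rightarrow> real ^ 'k ^ ('k + 'm))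
   \<Rightarrow> ('k::finite, 'm::finite) csp_basis" where
  "init_A N P z = hcat (N z) (P z)"

definition init_B ::
  "(real ^ ('k + 'm) \<Rightarrow> real ^ 'm ^ ('k + 'm)) \<Rightarrow> (real ^ ('k + 'm) \<Rightarrow> real ^ 'm)
   \<Rightarrow> (real ^ ('k + 'm) \<Rightarrow> real ^ 'k ^ ('k + 'm)) \<Rightarrow> (real ^ ('k + 'm) \<Rightarrow> real ^ 'k ^ ('k + 'm))
   \<Rightarrow> ('k::finite, 'm::finite) csp_dual" where
  "init_B N f P Q z =
     vcat (matrix_inv (jacobian f (at z) ** N z) ** jacobian f (at z))
          (matrix_inv (transpose (Q z) ** P z) ** transpose (Q z))"

end

theory Submission
  imports Defs
begin

text \<open>
  The order-one manifold is the zero set of \<open>B\<^sub>s H\<close> with the updated dual block \<open>B\<^sub>s\<close> evaluated on the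
  order-zero manifold, so only the limit of that block as \<open>\<epsilon> \<rightarrow> 0\<close> matters for the coefficient
  of \<open>\<epsilon>\<close>.  The limit is \<open>(Df N)\<^sup>-\<^sup>1 Df\<close>, the block that the method starts from: on
  the critical manifold \<open>H\<close> vanishes at \<open>\<epsilon> = 0\<close> and \<open>DH = N Df\<close>, so the fast row of \<open>\<Lambda>\<close> tends to
  \<open>Df (N | P) = (Df N | 0)\<close>, because the columns of \<open>P\<close> are orthogonal to the rows of \<open>Df\<close>; with
  \<open>Df N\<close> invertible, the correction \<open>\<Lambda>\<^sub>f\<^sub>f\<^sup>-\<^sup>1 \<Lambda>\<^sub>f\<^sub>s\<close> tends to \<open>0\<close>.  This is lemma
  \<open>csp_Bs_1_tendsto\<close>.

  Along the order-one manifold the vector field is itself of size \<open>\<epsilon>\<close>: by the chain rule \<open>H / \<epsilon>\<close>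
  tends to \<open>N D\<^sub>yf \<psi>\<^sub>1\<^sub>1 + G\<close> (lemma \<open>vfield_div_tendsto\<close>).  Dividing the equation
  \<open>B\<^sub>s H = 0\<close> by \<open>\<epsilon>\<close> and passing to the limit gives
  \<open>(Df N)\<^sup>-\<^sup>1 Df (N D\<^sub>yf \<psi>\<^sub>1\<^sub>1 + G) = 0\<close>, that is \<open>D\<^sub>yf \<psi>\<^sub>1\<^sub>1 = - (Df N)\<^sup>-\<^sup>1 Df G\<close>.
\<close>

section \<open>Limits of matrices and Jacobians\<close>

lemma bounded_bilinear_matrix_vector_mult:
  "bounded_bilinear ((*v) :: real ^ 'm ^ 'n \<Rightarrow> real ^ 'm \<Rightarrow> real ^ 'n)"
  unfolding bilinear_conv_bounded_bilinear[symmetric] bilinear_def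
  by (auto intro!: linearI simp: matrix_vector_mult_add_rdistrib matrix_vector_right_distrib
      matrix_vector_mult_scaleR scaleR_matrix_vector_assoc)

lemmas tendsto_matrix_vector_mult [tendsto_intros] =
  bounded_bilinear.tendsto[OF bounded_bilinear_matrix_vector_mult]

lemma tendsto_matrix_matrix_mult [tendsto_intros]:
  fixes A :: "'t \<Rightarrow> real ^ 'm ^ 'n" and B :: "'t \<Rightarrow> real ^ 'p ^ 'm"
  assumes "(A \<longlongrightarrow> a) F" "(B \<longlongrightarrow> b) F"
  shows "((\<lambda>t. A t ** B t) \<longlongrightarrow> a ** b) F"
  unfolding matrix_matrix_mult_def by (intro tendsto_intros assms)

lemma tendsto_transpose [tendsto_intros]:
  fixes A :: "'t \<Rightarrow> real ^ 'm ^ 'n"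
  assumes "(A \<longlongrightarrow> a) F"
  shows "((\<lambda>t. transpose (A t)) \<longlongrightarrow> transpose a) F"
  unfolding transpose_def by (intro tendsto_intros assms)

lemma tendsto_column [tendsto_intros]:
  fixes A :: "'t \<Rightarrow> real ^ 'm ^ 'n"
  assumes "(A \<longlongrightarrow> a) F"
  shows "((\<lambda>t. column j (A t)) \<longlongrightarrow> column j a) F"
  unfolding column_def by (intro tendsto_intros assms)

lemma tendsto_det [tendsto_intros]:
  fixes A :: "'t \<Rightarrow> real ^ 'n ^ 'n"
  assumes "(A \<longlongrightarrow> a) F"
  shows "((\<lambda>t. det (A t)) \<longlongrightarrow> det a) F"
  unfolding det_def by (intro tendsto_intros assms)

lemma matrix_inv_inverse:
  fixes A :: "real ^ 'n ^ 'n"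
  assumes "invertible A"
  shows "A ** matrix_inv A = mat 1" "matrix_inv A ** A = mat 1"
  using someI_ex[OF assms[unfolded invertible_def]] by (simp_all add: matrix_inv_def)

lemma matrix_inv_component_cramer:
  fixes A :: "real ^ 'n ^ 'n"
  assumes "det A \<noteq> 0"
  shows "matrix_inv A $ i $ j = det (\<chi> p q. if q = i then axis j 1 $ p else A $ p $ q) / det A"
proof -
  have "A *v column j (matrix_inv A) = axis j 1"
    using matrix_inv_inverse(1)[of A] assms
    by (simp add: invertible_det_nz matrix_vector_mult_basis[symmetric] matrix_vector_mul_assoc)
  from this cramer[OF assms] have "column j (matrix_inv A) =
      (\<chi> k. det (\<chi> p q. if q = k then axis j 1 $ p else A $ p $ q) / det A)"
    by blast
  then show ?thesis
    by (simp add: column_def vec_eq_iff)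
qed

text \<open>By Cramer's rule the entries of the inverse are quotients of determinants.\<close>

lemma tendsto_matrix_inv:
  fixes A :: "'t \<Rightarrow> real ^ 'n ^ 'n"
  assumes A: "(A \<longlongrightarrow> a) F" and a: "invertible a"
  shows "((\<lambda>t. matrix_inv (A t)) \<longlongrightarrow> matrix_inv a) F"
proof (intro vec_tendstoI)
  fix i j
  have a0: "det a \<noteq> 0" using a by (simp add: invertible_det_nz)
  have nz: "eventually (\<lambda>t. det (A t) \<noteq> 0) F"
    using tendsto_imp_eventually_ne[OF tendsto_det[OF A] a0] .
  have entry: "((\<lambda>t. if q = i then axis j 1 $ p else A t $ p $ q) \<longlongrightarrow>
      (if q = i then axis j 1 $ p else a $ p $ q)) F" for p q
    by (auto intro!: tendsto_intros A)
  have "((\<lambda>t. det (\<chi> p q. if q = i then axis j 1 $ p else A t $ p $ q) / det (A t)) \<longlongrightarrow>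
      det (\<chi> p q. if q = i then axis j 1 $ p else a $ p $ q) / det a) F"
    by (intro tendsto_intros entry A a0)
  then show "((\<lambda>t. matrix_inv (A t) $ i $ j) \<longlongrightarrow> matrix_inv a $ i $ j) F"
    unfolding matrix_inv_component_cramer[OF a0]
    by (rule Lim_transform_eventually)
      (use nz in eventually_elim, simp add: matrix_inv_component_cramer)
qed

lemma jacobian_eq_matrix:
  assumes "(F has_derivative F') (at z)"
  shows "jacobian F (at z) = matrix F'"
  using frechet_derivative_at[OF assms] by (simp add: jacobian_def)

lemma C1_on_tendsto:
  assumes "C1_on F W" "z\<^sub>0 \<in> W" "(z \<longlongrightarrow> z\<^sub>0) T"
  shows "((\<lambda>t. F (z t)) \<longlongrightarrow> F z\<^sub>0) T"
  using assms unfolding C1_on_def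
  by (metis has_derivative_continuous isCont_tendsto_compose)

lemma C1_on_compose_linear:
  assumes "C1_on F W" "bounded_linear L"
  shows "C1_on (\<lambda>w. L (F w)) W"
proof -
  obtain F' where F': "\<forall>x\<in>W. (F has_derivative blinfun_apply (F' x)) (at x)" "continuous_on W F'"
    using assms(1) unfolding C1_on_def by blast
  have "((\<lambda>w. L (F w)) has_derivative blinfun_apply (Blinfun L o\<^sub>L F' x)) (at x)" if "x \<in> W" for x
    using bounded_linear.has_derivative[OF assms(2), of F "blinfun_apply (F' x)" "at x"] F'(1) that
    by (simp add: blinfun_compose.rep_eq o_def bounded_linear_Blinfun_apply[OF assms(2)])
  moreover have "continuous_on W (\<lambda>x. Blinfun L o\<^sub>L F' x)"
    by (intro continuous_intros F'(2))
  ultimately show ?thesis unfolding C1_on_def by (intro exI[of _ "\<lambda>x. Blinfun L o\<^sub>L F' x"]) simp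
qed

lemma C1_on_jacobian_tendsto:
  fixes F :: "real ^ 'n \<Rightarrow> real ^ 'm"
  assumes "C1_on F W" and W: "open W" "z\<^sub>0 \<in> W" and z: "(z \<longlongrightarrow> z\<^sub>0) T"
  shows "((\<lambda>t. jacobian F (at (z t))) \<longlongrightarrow> jacobian F (at z\<^sub>0)) T"
proof -
  obtain F' where F': "\<And>x. x \<in> W \<Longrightarrow> (F has_derivative blinfun_apply (F' x)) (at x)"
      and cont: "continuous_on W F'"
    using assms(1) unfolding C1_on_def by blast
  have "((\<lambda>t. F' (z t)) \<longlongrightarrow> F' z\<^sub>0) T"
    using cont W z by (simp add: continuous_on_eq_continuous_at isCont_tendsto_compose)
  then have "((\<lambda>t. matrix (F' (z t))) \<longlongrightarrow> matrix (F' z\<^sub>0)) T"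
    unfolding matrix_def by (intro tendsto_intros)
  moreover have "eventually (\<lambda>t. z t \<in> W) T"
    using topological_tendstoD[OF z W] .
  ultimately show ?thesis
    unfolding jacobian_eq_matrix[OF F'[OF W(2)]]
    by (rule Lim_transform_eventually[OF _ eventually_mono])
      (simp add: jacobian_eq_matrix[OF F'])
qed

section \<open>The vector field near the critical manifold\<close>

lemma vfield_tendsto:
  assumes "C1_on N UNIV" "C1_on f UNIV"
    and "C1_on (\<lambda>(z, \<epsilon>). G z \<epsilon>) (UNIV \<times> {-\<epsilon>\<^sub>0<..<\<epsilon>\<^sub>0})" "\<epsilon>\<^sub>0 > 0"
    and "(z \<longlongrightarrow> z\<^sub>0) T" "(e \<longlongrightarrow> 0) T"
  shows "((\<lambda>t. vfield N f G (e t) (z t)) \<longlongrightarrow> N z\<^sub>0 *v f z\<^sub>0) T"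
proof -
  have "((\<lambda>t. G (z t) (e t)) \<longlongrightarrow> G z\<^sub>0 0) T"
    using C1_on_tendsto[OF assms(3), of "(z\<^sub>0, 0)" "\<lambda>t. (z t, e t)" T] assms(4)
      tendsto_Pair[OF assms(5,6)] by simp
  then have "((\<lambda>t. vfield N f G (e t) (z t)) \<longlongrightarrow> N z\<^sub>0 *v f z\<^sub>0 + 0 *\<^sub>R G z\<^sub>0 0) T"
    unfolding vfield_def using C1_on_tendsto[OF assms(1) UNIV_I assms(5)]
      C1_on_tendsto[OF assms(2) UNIV_I assms(5)] assms(6)
    by (intro tendsto_intros)
  then show ?thesis by simp
qed

text \<open>
  The product rule gives \<open>DH = N Df + (DN) f + \<epsilon> DG\<close>; the last two terms vanish in the limit
  because \<open>f z\<^sub>0 = 0\<close> and \<open>\<epsilon> \<rightarrow> 0\<close>.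
\<close>

lemma jacobian_vfield_tendsto:
  fixes N :: "real ^ 'n \<Rightarrow> real ^ 'm ^ 'n"
  assumes N: "C1_on N UNIV" and f: "C1_on f UNIV"
    and G: "C1_on (\<lambda>(z, \<epsilon>). G z \<epsilon>) (UNIV \<times> {-\<epsilon>\<^sub>0<..<\<epsilon>\<^sub>0})" and eps: "\<epsilon>\<^sub>0 > 0"
    and z: "(z \<longlongrightarrow> z\<^sub>0) T" and e: "(e \<longlongrightarrow> 0) T" and f0: "f z\<^sub>0 = 0"
  shows "((\<lambda>t. jacobian (vfield N f G (e t)) (at (z t))) \<longlongrightarrow> N z\<^sub>0 ** jacobian f (at z\<^sub>0)) T"
proof -
  let ?I = "{-\<epsilon>\<^sub>0<..<\<epsilon>\<^sub>0}"
  obtain N' where N': "\<And>x. (N has_derivative blinfun_apply (N' x)) (at x)" and cN: "continuous_on UNIV N'"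
    using N unfolding C1_on_def by blast
  obtain f' where f': "\<And>x. (f has_derivative blinfun_apply (f' x)) (at x)" and cf: "continuous_on UNIV f'"
    using f unfolding C1_on_def by blast
  obtain G' where G': "\<And>p. p \<in> UNIV \<times> ?I \<Longrightarrow> ((\<lambda>(z, \<epsilon>). G z \<epsilon>) has_derivative blinfun_apply (G' p)) (at p)"
    and cG: "continuous_on (UNIV \<times> ?I) G'"
    using G unfolding C1_on_def by blast
  define DH where "DH w \<epsilon> v = N w *v f' w v + N' w v *v f w + \<epsilon> *\<^sub>R G' (w, \<epsilon>) (v, 0)" for w \<epsilon> v
  have DH: "(vfield N f G \<epsilon> has_derivative DH w \<epsilon>) (at w)" if "\<epsilon> \<in> ?I" for w \<epsilon>
  proof -
    have "((\<lambda>w. (w, \<epsilon>)) has_derivative (\<lambda>v. (v, 0))) (at w)"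
      by (auto intro!: derivative_eq_intros)
    from diff_chain_at[OF this G'] that
    have "((\<lambda>w. G w \<epsilon>) has_derivative (\<lambda>v. G' (w, \<epsilon>) (v, 0))) (at w)"
      by (simp add: o_def)
    then show ?thesis
      unfolding vfield_def DH_def
      by (intro has_derivative_add bounded_bilinear.FDERIV[OF bounded_bilinear_matrix_vector_mult]
          has_derivative_scaleR_right N' f')
  qed
  have e_in: "eventually (\<lambda>t. e t \<in> ?I) T"
    using topological_tendstoD[OF e, of ?I] eps by auto
  have lims: "((\<lambda>t. N (z t)) \<longlongrightarrow> N z\<^sub>0) T" "((\<lambda>t. f (z t)) \<longlongrightarrow> f z\<^sub>0) T"
      "((\<lambda>t. N' (z t)) \<longlongrightarrow> N' z\<^sub>0) T" "((\<lambda>t. f' (z t)) \<longlongrightarrow> f' z\<^sub>0) T"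
    using C1_on_tendsto[OF N UNIV_I z] C1_on_tendsto[OF f UNIV_I z] cN cf z
    by (simp_all add: continuous_on_eq_continuous_at isCont_tendsto_compose)
  have limG: "((\<lambda>t. G' (z t, e t)) \<longlongrightarrow> G' (z\<^sub>0, 0)) T"
  proof -
    have "isCont G' (z\<^sub>0, 0)"
      using cG eps by (simp add: continuous_on_eq_continuous_at open_Times)
    then show ?thesis by (rule isCont_tendsto_compose) (intro tendsto_intros z e)
  qed
  have "((\<lambda>t. DH (z t) (e t) v) \<longlongrightarrow> DH z\<^sub>0 0 v) T" for v
    unfolding DH_def by (intro tendsto_intros lims limG e)
  then have "((\<lambda>t. matrix (DH (z t) (e t))) \<longlongrightarrow> matrix (DH z\<^sub>0 0)) T"
    unfolding matrix_def by (intro tendsto_intros)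
  moreover have "matrix (DH z\<^sub>0 0) = N z\<^sub>0 ** jacobian f (at z\<^sub>0)"
  proof -
    have "linear (f' z\<^sub>0)" by (rule bounded_linear.linear[OF blinfun.bounded_linear_right])
    moreover have "DH z\<^sub>0 0 = (\<lambda>v. N z\<^sub>0 *v f' z\<^sub>0 v)" by (simp add: DH_def f0 fun_eq_iff)
    ultimately show ?thesis
      by (simp add: jacobian_eq_matrix[OF f'] matrix_compose[of "f' z\<^sub>0" "(*v) (N z\<^sub>0)", unfolded o_def]
          matrix_of_matrix_vector_mul)
  qed
  ultimately have "((\<lambda>t. matrix (DH (z t) (e t))) \<longlongrightarrow> N z\<^sub>0 ** jacobian f (at z\<^sub>0)) T"
    by simp
  then show ?thesis
    by (rule Lim_transform_eventually)
      (use e_in in eventually_elim, simp add: jacobian_eq_matrix[OF DH])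
qed

text \<open>This is the chain rule for a curve that is only known to be differentiable at its endpoint.\<close>

lemma difference_quotient_tendsto:
  fixes g :: "'a::real_normed_vector \<Rightarrow> 'b::real_normed_vector"
  assumes g: "(g has_derivative g') (at p)"
    and c: "((\<lambda>t. (c t - p) /\<^sub>R t) \<longlongrightarrow> u) (at_right (0::real))"
  shows "((\<lambda>t. (g (c t) - g p) /\<^sub>R t) \<longlongrightarrow> g' u) (at_right 0)"
proof -
  have vec: "(b has_vector_derivative b') (at 0 within {0<..}) \<longleftrightarrow>
      ((\<lambda>t. (b t - b 0) /\<^sub>R t) \<longlongrightarrow> b') (at_right 0)" for b :: "real \<Rightarrow> 'v::real_normed_vector" and b'
  proof -
    have "(b has_vector_derivative b') (at 0 within {0<..}) \<longleftrightarrow>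
        ((\<lambda>t. (1 / norm t) *\<^sub>R (b t - (b 0 + t *\<^sub>R b'))) \<longlongrightarrow> 0) (at_right 0)"
      by (simp add: has_vector_derivative_def has_derivative_within bounded_linear_scaleR_left)
    also have "\<dots> \<longleftrightarrow> ((\<lambda>t. (b t - b 0) /\<^sub>R t - b') \<longlongrightarrow> 0) (at_right 0)"
      by (intro tendsto_cong eventually_mono[OF eventually_at_right_less])
        (simp add: algebra_simps divide_inverse_commute)
    also have "\<dots> \<longleftrightarrow> ((\<lambda>t. (b t - b 0) /\<^sub>R t) \<longlongrightarrow> b') (at_right 0)"
      by (rule Lim_null[symmetric])
    finally show ?thesis .
  qed
  define c' where "c' t = (if t = 0 then p else c t)" for t
  have pos: "eventually (\<lambda>t. c' t = c t) (at_right 0)"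
    by (rule eventually_mono[OF eventually_at_right_less]) (simp add: c'_def)
  have "((\<lambda>t. (c' t - c' 0) /\<^sub>R t) \<longlongrightarrow> u) (at_right 0)"
    by (rule Lim_transform_eventually[OF c])
      (use pos in eventually_elim, simp add: c'_def)
  then have "(c' has_vector_derivative u) (at 0 within {0<..})"
    by (simp add: vec)
  moreover have "(g has_derivative g') (at (c' 0) within c' ` {0<..})"
    using g by (simp add: c'_def has_derivative_at_withinI)
  ultimately have "((g \<circ> c') has_vector_derivative g' u) (at 0 within {0<..})"
    by (rule vector_derivative_diff_chain_within)
  then have "((\<lambda>t. (g (c' t) - g p) /\<^sub>R t) \<longlongrightarrow> g' u) (at_right 0)"
    by (simp add: vec c'_def)
  then show ?thesis
    by (rule Lim_transform_eventually) (use pos in eventually_elim, simp)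
qed

lemma vfield_div_tendsto:
  assumes "C1_on N UNIV" "C1_on f UNIV"
    and "C1_on (\<lambda>(z, \<epsilon>). G z \<epsilon>) (UNIV \<times> {-\<epsilon>\<^sub>0<..<\<epsilon>\<^sub>0})" "\<epsilon>\<^sub>0 > 0"
    and z: "(z \<longlongrightarrow> z\<^sub>0) (at_right 0)" and fz: "((\<lambda>\<epsilon>. f (z \<epsilon>) /\<^sub>R \<epsilon>) \<longlongrightarrow> d) (at_right 0)"
  shows "((\<lambda>\<epsilon>. vfield N f G \<epsilon> (z \<epsilon>) /\<^sub>R \<epsilon>) \<longlongrightarrow> N z\<^sub>0 *v d + G z\<^sub>0 0) (at_right 0)"
proof -
  have "((\<lambda>\<epsilon>. G (z \<epsilon>) \<epsilon>) \<longlongrightarrow> G z\<^sub>0 0) (at_right 0)"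
    using C1_on_tendsto[OF assms(3), of "(z\<^sub>0, 0)" "\<lambda>\<epsilon>. (z \<epsilon>, \<epsilon>)"] assms(4)
      tendsto_Pair[OF z tendsto_ident_at] by simp
  then have "((\<lambda>\<epsilon>. N (z \<epsilon>) *v (f (z \<epsilon>) /\<^sub>R \<epsilon>) + G (z \<epsilon>) \<epsilon>) \<longlongrightarrow> N z\<^sub>0 *v d + G z\<^sub>0 0) (at_right 0)"
    by (intro tendsto_intros fz C1_on_tendsto[OF assms(1) UNIV_I z])
  then show ?thesis
    by (rule Lim_transform_eventually)
      (rule eventually_mono[OF eventually_at_right_less],
        simp add: vfield_def matrix_vector_mult_scaleR scaleR_add_right)
qed

section \<open>The updated dual block\<close>

lemma top_rows_matrix_mult: "top_rows (M ** C) = top_rows M ** C"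
  by (simp add: top_rows_def matrix_matrix_mult_def vec_eq_iff)

text \<open>
  The factor \<open>I - L\<close> of the update leaves the fast rows alone, since the fast rows of \<open>L\<close> vanish.
\<close>

lemma csp_Bs_1:
  "csp_Bs H A B 1 z = top_rows (B z) +
     (matrix_inv (Lambda_ff (csp_Lambda H A B z)) ** Lambda_fs (csp_Lambda H A B z)) ** bot_rows (B z)"
proof -
  have L: "top_rows ((mat 1 - csp_L M) ** C) = top_rows C"
    for M :: "real ^ ('b + 'a) ^ ('b + 'a)" and C :: "real ^ ('a + 'b) ^ ('b + 'a)"
    by (simp add: top_rows_def csp_L_def vcat_def matrix_matrix_mult_def vec_eq_iff mat_def
        if_distrib[where f = "\<lambda>a. a * b" for b] cong: if_cong)
  have sum_split: "sum g UNIV = (\<Sum>i\<in>UNIV. g (Inl i)) + (\<Sum>i\<in>UNIV. g (Inr i))"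
    for g :: "'b + 'a \<Rightarrow> real"
    by (simp add: UNIV_Plus_UNIV[symmetric] sum.Plus del: UNIV_Plus_UNIV)
  have W: "top_rows ((mat 1 + vcat (hcat 0 W) 0) ** C) = top_rows C + W ** bot_rows C"
    for W :: "real ^ 'a ^ 'b" and C :: "real ^ ('a + 'b) ^ ('b + 'a)"
    by (simp add: top_rows_def bot_rows_def vcat_def hcat_def matrix_matrix_mult_def vec_eq_iff
        sum_split mat_def if_distrib[where f = "\<lambda>a. a * b" for b] cong: if_cong)
  have U: "top_rows ((mat 1 + csp_U M) ** C) =
      top_rows C + (matrix_inv (Lambda_ff M) ** Lambda_fs M) ** bot_rows C"
    for M :: "real ^ ('b + 'a) ^ ('b + 'a)" and C :: "real ^ ('a + 'b) ^ ('b + 'a)"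
    unfolding csp_U_def by (rule W)
  show ?thesis
    by (simp add: csp_Bs_def csp_def csp_step_def L U matrix_mul_assoc[symmetric])
qed

lemma C1_on_column_init_A:
  assumes N: "C1_on N UNIV" and P: "C1_on P \<Omega>"
  shows "C1_on (\<lambda>w. column j (init_A N P w)) \<Omega>"
proof (cases j)
  case (Inl a)
  have "C1_on N \<Omega>"
    using N unfolding C1_on_def by (meson UNIV_I continuous_on_subset subset_UNIV)
  from C1_on_compose_linear[OF this, of "column a"] show ?thesis
    by (simp add: Inl init_A_def hcat_def column_def)
       (simp add: linear_conv_bounded_linear[symmetric] linear_iff column_def vec_eq_iff)
next
  case (Inr b)
  from C1_on_compose_linear[OF P, of "column b"] show ?thesis
    by (simp add: Inr init_A_def hcat_def column_def)
       (simp add: linear_conv_bounded_linear[symmetric] linear_iff column_def vec_eq_iff)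
qed

text \<open>
  In \<open>(DH) A\<^sub>j - (DA\<^sub>j) H\<close> only the first term survives on the critical manifold, where \<open>H\<close> tends
  to \<open>N f = 0\<close>.
\<close>

lemma bracket_init_A_tendsto:
  fixes N :: "real ^ ('k::finite + 'm::finite) \<Rightarrow> real ^ 'm ^ ('k + 'm)"
    and P :: "real ^ ('k + 'm) \<Rightarrow> real ^ 'k ^ ('k + 'm)"
  assumes N: "C1_on N UNIV" and f: "C1_on f UNIV"
    and G: "C1_on (\<lambda>(z, \<epsilon>). G z \<epsilon>) (UNIV \<times> {-\<epsilon>\<^sub>0<..<\<epsilon>\<^sub>0})" and eps: "\<epsilon>\<^sub>0 > 0"
    and P: "C1_on P \<Omega>" and \<Omega>: "open \<Omega>" "z\<^sub>0 \<in> \<Omega>"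
    and z: "(z \<longlongrightarrow> z\<^sub>0) T" and e: "(e \<longlongrightarrow> 0) T" and f0: "f z\<^sub>0 = 0"
  shows "((\<lambda>t. bracket (init_A N P) (vfield N f G (e t)) (z t)) \<longlongrightarrow>
          N z\<^sub>0 ** jacobian f (at z\<^sub>0) ** init_A N P z\<^sub>0) T"
proof (intro vec_tendstoI)
  fix i j
  let ?c = "\<lambda>w. column j (init_A N P w)"
  have C: "C1_on ?c \<Omega>"
    by (rule C1_on_column_init_A[OF N P])
  have "((\<lambda>t. (jacobian (vfield N f G (e t)) (at (z t)) *v ?c (z t)
          - jacobian ?c (at (z t)) *v vfield N f G (e t) (z t)) $ i) \<longlongrightarrow>
        ((N z\<^sub>0 ** jacobian f (at z\<^sub>0)) *v ?c z\<^sub>0 - jacobian ?c (at z\<^sub>0) *v (N z\<^sub>0 *v f z\<^sub>0)) $ i) T"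
    by (intro tendsto_intros jacobian_vfield_tendsto[OF N f G eps z e f0]
        vfield_tendsto[OF N f G eps z e] C1_on_tendsto[OF C \<Omega>(2) z]
        C1_on_jacobian_tendsto[OF C \<Omega> z])
  moreover have "((N z\<^sub>0 ** jacobian f (at z\<^sub>0)) *v ?c z\<^sub>0 - jacobian ?c (at z\<^sub>0) *v (N z\<^sub>0 *v f z\<^sub>0)) $ i
      = (N z\<^sub>0 ** jacobian f (at z\<^sub>0) ** init_A N P z\<^sub>0) $ i $ j"
    by (simp add: f0 matrix_vector_mult_def matrix_matrix_mult_def column_def)
  ultimately show "((\<lambda>t. bracket (init_A N P) (vfield N f G (e t)) (z t) $ i $ j) \<longlongrightarrow>
      (N z\<^sub>0 ** jacobian f (at z\<^sub>0) ** init_A N P z\<^sub>0) $ i $ j) T"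
    by (simp add: bracket_def)
qed

lemma is_perp_transpose_mult:
  assumes "is_perp (transpose D) P"
  shows "D ** P = 0"
proof -
  have "(D ** P) $ i $ j = 0" for i j
  proof -
    have "column j P \<in> (span (columns (transpose D)))\<^sup>\<bottom>"
      using assms unfolding is_perp_def by (metis (mono_tags) columns_def mem_Collect_eq span_base UNIV_I)
    moreover have "row i D \<in> span (columns (transpose D))"
      by (intro span_base) (auto simp: rows_def)
    ultimately have "row i D \<bullet> column j P = 0"
      by (auto simp: orthogonal_comp_def orthogonal_def)
    then show ?thesis
      by (simp add: matrix_matrix_mult_def inner_vec_def row_def column_def)
  qed
  then show ?thesis by (simp add: vec_eq_iff)
qed

text \<open>
  With \<open>D = Df\<close> at the critical manifold, \<open>B\<^sub>s N = I\<close> turns the limit \<open>B\<^sub>s N D (N | P)\<close> of the fast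
  row of \<open>\<Lambda>\<close> into \<open>(D N | D P) = (D N | 0)\<close>, so the correction made by the update disappears in the limit.
\<close>

lemma csp_Bs_1_tendsto:
  fixes N :: "real ^ ('k::finite + 'm::finite) \<Rightarrow> real ^ 'm ^ ('k + 'm)"
    and P Q :: "real ^ ('k + 'm) \<Rightarrow> real ^ 'k ^ ('k + 'm)"
  assumes N: "C1_on N UNIV" and f: "C1_on f UNIV"
    and G: "C1_on (\<lambda>(z, \<epsilon>). G z \<epsilon>) (UNIV \<times> {-\<epsilon>\<^sub>0<..<\<epsilon>\<^sub>0})" and eps: "\<epsilon>\<^sub>0 > 0"
    and \<Omega>: "open \<Omega>" "z\<^sub>0 \<in> \<Omega>" and P: "C1_on P \<Omega>" and Q: "C1_on Q \<Omega>"
    and perp: "is_perp (transpose (jacobian f (at z\<^sub>0))) (P z\<^sub>0)"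
    and inv_fN: "invertible (jacobian f (at z\<^sub>0) ** N z\<^sub>0)"
    and inv_QP: "invertible (transpose (Q z\<^sub>0) ** P z\<^sub>0)"
    and z: "(z \<longlongrightarrow> z\<^sub>0) T" and e: "(e \<longlongrightarrow> 0) T" and f0: "f z\<^sub>0 = 0"
  shows "((\<lambda>t. csp_Bs (vfield N f G (e t)) (init_A N P) (init_B N f P Q) 1 (z t)) \<longlongrightarrow>
          matrix_inv (jacobian f (at z\<^sub>0) ** N z\<^sub>0) ** jacobian f (at z\<^sub>0)) T"
proof -
  let ?D = "\<lambda>w. jacobian f (at w)" and ?A = "init_A N P" and ?B = "init_B N f P Q"
  define M where "M t = csp_Lambda (vfield N f G (e t)) ?A ?B (z t)" for t
  define M\<^sub>0 where "M\<^sub>0 = ?B z\<^sub>0 ** (N z\<^sub>0 ** ?D z\<^sub>0 ** ?A z\<^sub>0)"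
  have top_B: "top_rows (?B w) = matrix_inv (?D w ** N w) ** ?D w"
    and bot_B: "bot_rows (?B w) = matrix_inv (transpose (Q w) ** P w) ** transpose (Q w)" for w
    by (simp_all add: init_B_def vcat_def top_rows_def bot_rows_def vec_eq_iff)
  have lim_D: "((\<lambda>t. ?D (z t)) \<longlongrightarrow> ?D z\<^sub>0) T"
    by (rule C1_on_jacobian_tendsto[OF f open_UNIV UNIV_I z])
  have lim_top: "((\<lambda>t. top_rows (?B (z t))) \<longlongrightarrow> top_rows (?B z\<^sub>0)) T"
    unfolding top_B
    by (intro tendsto_intros tendsto_matrix_inv inv_fN lim_D C1_on_tendsto[OF N UNIV_I z])
  have lim_bot: "((\<lambda>t. bot_rows (?B (z t))) \<longlongrightarrow> bot_rows (?B z\<^sub>0)) T"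
    unfolding bot_B
    by (intro tendsto_intros tendsto_matrix_inv inv_QP
        C1_on_tendsto[OF P \<Omega>(2) z] C1_on_tendsto[OF Q \<Omega>(2) z])
  have "((\<lambda>t. top_rows (M t)) \<longlongrightarrow> top_rows M\<^sub>0) T"
    unfolding M_def M\<^sub>0_def csp_Lambda_def top_rows_matrix_mult
    by (intro tendsto_intros lim_top bracket_init_A_tendsto[OF N f G eps P \<Omega> z e f0])
  then have lim_M: "((\<lambda>t. Lambda_ff (M t)) \<longlongrightarrow> Lambda_ff M\<^sub>0) T"
      "((\<lambda>t. Lambda_fs (M t)) \<longlongrightarrow> Lambda_fs M\<^sub>0) T"
    unfolding Lambda_ff_def Lambda_fs_def left_cols_def right_cols_def
    by (intro tendsto_intros; assumption)+
  have "top_rows M\<^sub>0 = (matrix_inv (?D z\<^sub>0 ** N z\<^sub>0) ** (?D z\<^sub>0 ** N z\<^sub>0)) ** (?D z\<^sub>0 ** ?A z\<^sub>0)"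
    unfolding M\<^sub>0_def top_rows_matrix_mult top_B by (simp add: matrix_mul_assoc)
  then have top_M\<^sub>0: "top_rows M\<^sub>0 = ?D z\<^sub>0 ** ?A z\<^sub>0"
    by (simp add: matrix_inv_inverse(2)[OF inv_fN])
  have ff: "Lambda_ff M\<^sub>0 = ?D z\<^sub>0 ** N z\<^sub>0"
    by (simp add: Lambda_ff_def top_M\<^sub>0 init_A_def left_cols_def hcat_def matrix_matrix_mult_def)
  have "Lambda_fs M\<^sub>0 = ?D z\<^sub>0 ** P z\<^sub>0"
    by (simp add: Lambda_fs_def top_M\<^sub>0 init_A_def right_cols_def hcat_def matrix_matrix_mult_def)
  then have fs: "Lambda_fs M\<^sub>0 = 0"
    by (simp add: is_perp_transpose_mult[OF perp])
  have "((\<lambda>t. top_rows (?B (z t)) +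
          matrix_inv (Lambda_ff (M t)) ** Lambda_fs (M t) ** bot_rows (?B (z t))) \<longlongrightarrow>
        top_rows (?B z\<^sub>0) +
          matrix_inv (Lambda_ff M\<^sub>0) ** Lambda_fs M\<^sub>0 ** bot_rows (?B z\<^sub>0)) T"
    by (intro tendsto_intros tendsto_matrix_inv lim_top lim_bot lim_M) (simp add: ff inv_fN)
  then show ?thesis
    unfolding csp_Bs_1 M_def fs top_B by simp
qed

section \<open>The coefficient of order one\<close>

lemma inj_zjoin: "zjoin x y = zjoin x' y' \<longleftrightarrow> x = x' \<and> y = y'"
  by (auto simp: zjoin_def vec_eq_iff split: sum.splits)

lemma has_derivative_zjoin: "(zjoin x has_derivative zjoin 0) (at y)"
proof -
  have "bounded_linear (zjoin 0)"
    unfolding linear_conv_bounded_linear[symmetric]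
    by (rule linearI) (auto simp: zjoin_def vec_eq_iff split: sum.splits)
  from has_derivative_add[OF has_derivative_const[of "zjoin x 0"] bounded_linear_imp_has_derivative[OF this]]
  have "((\<lambda>y. zjoin x 0 + zjoin 0 y) has_derivative zjoin 0) (at y)"
    by simp
  moreover have "(\<lambda>y. zjoin x 0 + zjoin 0 y) = zjoin x"
    by (auto simp: zjoin_def vec_eq_iff fun_eq_iff split: sum.splits)
  ultimately show ?thesis
    by (rule back_subst)
qed

lemma tendsto_zjoin:
  assumes "(y \<longlongrightarrow> y\<^sub>0) T"
  shows "((\<lambda>t. zjoin x (y t)) \<longlongrightarrow> zjoin x y\<^sub>0) T"
  using has_derivative_continuous[OF has_derivative_zjoin] assms by (rule isCont_tendsto_compose)

lemma csp_Bs_1_vfield_on_graph: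
  assumes "local_graph X h\<^sub>0 \<epsilon>\<^sub>0 (\<lambda>\<epsilon>. csp_manifold_Suc \<Omega> X (H \<epsilon>) A B 0 (\<lambda>x. \<psi>\<^sub>0 x \<epsilon>)) \<psi>\<^sub>1"
    and "x \<in> X" "0 < \<epsilon>" "\<epsilon> < \<epsilon>\<^sub>0"
  shows "csp_Bs (H \<epsilon>) A B 1 (zjoin x (\<psi>\<^sub>0 x \<epsilon>)) *v H \<epsilon> (zjoin x (\<psi>\<^sub>1 x \<epsilon>)) = 0"
proof -
  have "zjoin x (\<psi>\<^sub>1 x \<epsilon>) \<in> csp_manifold_Suc \<Omega> X (H \<epsilon>) A B 0 (\<lambda>x. \<psi>\<^sub>0 x \<epsilon>)"
    using assms unfolding local_graph_def graph_over_def by blast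
  then show ?thesis
    by (auto simp: csp_manifold_Suc_def inj_zjoin)
qed

lemma tendsto_of_bigo_ident:
  fixes c :: "real \<Rightarrow> 'a::real_normed_vector"
  assumes "(\<lambda>\<epsilon>. norm (c \<epsilon> - p)) \<in> O[at_right 0](\<lambda>\<epsilon>. \<epsilon>)"
  shows "(c \<longlongrightarrow> p) (at_right 0)"
proof -
  from assms obtain C where C: "eventually (\<lambda>\<epsilon>. norm (c \<epsilon> - p) \<le> C * norm \<epsilon>) (at_right 0)"
    by (auto elim: landau_o.bigE)
  have "((\<lambda>\<epsilon>. C * norm \<epsilon>) \<longlongrightarrow> 0) (at_right (0::real))"
    by (auto intro!: tendsto_eq_intros)
  from Lim_null_comparison[OF C this] show ?thesis
    by (rule LIM_zero_cancel)
qed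

lemma difference_quotient_of_bigo_square:
  fixes c :: "real \<Rightarrow> 'a::real_normed_vector"
  assumes "(\<lambda>\<epsilon>. norm (c \<epsilon> - (p + \<epsilon> *\<^sub>R u))) \<in> O[at_right 0](\<lambda>\<epsilon>. \<epsilon>\<^sup>2)"
  shows "((\<lambda>\<epsilon>. (c \<epsilon> - p) /\<^sub>R \<epsilon>) \<longlongrightarrow> u) (at_right 0)"
proof -
  from assms obtain C where
    C: "eventually (\<lambda>\<epsilon>. norm (c \<epsilon> - (p + \<epsilon> *\<^sub>R u)) \<le> C * norm (\<epsilon>\<^sup>2)) (at_right 0)"
    by (auto elim: landau_o.bigE)
  have "eventually (\<lambda>\<epsilon>. norm ((c \<epsilon> - p) /\<^sub>R \<epsilon> - u) \<le> C * \<epsilon>) (at_right 0)"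
    using C eventually_at_right_less[of 0]
  proof eventually_elim
    case (elim \<epsilon>)
    have "(c \<epsilon> - p) /\<^sub>R \<epsilon> - u = (c \<epsilon> - (p + \<epsilon> *\<^sub>R u)) /\<^sub>R \<epsilon>"
      using elim(2) by (simp add: algebra_simps)
    then have "norm ((c \<epsilon> - p) /\<^sub>R \<epsilon> - u) = norm (c \<epsilon> - (p + \<epsilon> *\<^sub>R u)) / \<epsilon>"
      using elim(2) by (simp add: divide_inverse_commute)
    also have "\<dots> \<le> C * \<epsilon>"
      using elim by (simp add: divide_le_eq power2_eq_square mult.assoc)
    finally show ?case .
  qed
  moreover have "((\<lambda>\<epsilon>. C * \<epsilon>) \<longlongrightarrow> 0) (at_right 0)"
    by (auto intro!: tendsto_eq_intros)
  ultimately have "((\<lambda>\<epsilon>. (c \<epsilon> - p) /\<^sub>R \<epsilon> - u) \<longlongrightarrow> 0) (at_right 0)"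
    by (rule Lim_null_comparison)
  then show ?thesis by (rule LIM_zero_cancel)
qed

lemma tendsto_of_difference_quotient:
  fixes c :: "real \<Rightarrow> 'a::real_normed_vector"
  assumes "((\<lambda>\<epsilon>. (c \<epsilon> - p) /\<^sub>R \<epsilon>) \<longlongrightarrow> u) (at_right 0)"
  shows "(c \<longlongrightarrow> p) (at_right 0)"
proof -
  have "((\<lambda>\<epsilon>. p + \<epsilon> *\<^sub>R ((c \<epsilon> - p) /\<^sub>R \<epsilon>)) \<longlongrightarrow> p + 0 *\<^sub>R u) (at_right 0)"
    by (intro tendsto_intros assms)
  then have "((\<lambda>\<epsilon>. p + \<epsilon> *\<^sub>R ((c \<epsilon> - p) /\<^sub>R \<epsilon>)) \<longlongrightarrow> p) (at_right 0)"
    by simp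
  then show ?thesis
    by (rule Lim_transform_eventually)
      (rule eventually_mono[OF eventually_at_right_less], simp)
qed

theorem mainTheorem3:
  fixes N :: "real ^ ('k::finite + 'm::finite) \<Rightarrow> real ^ 'm ^ ('k + 'm)"
    and f :: "real ^ ('k + 'm) \<Rightarrow> real ^ 'm"
    and G :: "real ^ ('k + 'm) \<Rightarrow> real \<Rightarrow> real ^ ('k + 'm)"
    and P Q :: "real ^ ('k + 'm) \<Rightarrow> real ^ 'k ^ ('k + 'm)"
    and X :: "(real ^ 'k) set" and h\<^sub>0 :: "real ^ 'k \<Rightarrow> real ^ 'm"
    and \<Omega> :: "(real ^ ('k + 'm)) set" and \<epsilon>\<^sub>0 :: real
    and \<psi>\<^sub>0 \<psi>\<^sub>1 :: "real ^ 'k \<Rightarrow> real \<Rightarrow> real ^ 'm"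
    and \<psi>\<^sub>1\<^sub>1 :: "real ^ 'k \<Rightarrow> real ^ 'm"
  defines "H \<equiv> vfield N f G"
    and "A\<^sub>0 \<equiv> init_A N P"
    and "B\<^sub>0 \<equiv> init_B N f P Q"
  assumes eps: "\<epsilon>\<^sub>0 > 0"
    \<comment> \<open>smoothness of the system\<close>
    and "C1_on N UNIV" and "C1_on f UNIV"
    and "C1_on (\<lambda>(z, \<epsilon>). G z \<epsilon>) (UNIV \<times> {-\<epsilon>\<^sub>0<..<\<epsilon>\<^sub>0})"
    \<comment> \<open>the critical manifold\<close>
    and "differentiable_submanifold {z. f z = 0}"
    and "\<forall>z. f z = 0 \<longrightarrow> rank (N z) = CARD('m)"
    \<comment> \<open>local coordinates\<close>
    and "open X" and "open \<Omega>"
    and "{z. f z = 0} \<inter> \<Omega> = graph_over X h\<^sub>0"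
    and "\<forall>x\<in>X. invertible (jacobian (\<lambda>y. f (zjoin x y)) (at (h\<^sub>0 x)))"
    \<comment> \<open>smooth choices of the orthogonal complements\<close>
    and "C1_on P \<Omega>" and "C1_on Q \<Omega>"
    and "\<forall>z\<in>\<Omega>. is_perp (transpose (jacobian f (at z))) (P z)"
    and "\<forall>z\<in>\<Omega>. is_perp (N z) (Q z)"
    \<comment> \<open>the inverses exist near the critical manifold\<close>
    and "\<forall>z\<in>\<Omega>. invertible (jacobian f (at z) ** N z)"
    and "\<forall>z\<in>\<Omega>. invertible (transpose (Q z) ** P z)"
    and "\<forall>z\<in>\<Omega>. \<forall>\<epsilon>. 0 < \<epsilon> \<and> \<epsilon> < \<epsilon>\<^sub>0 \<longrightarrow>
           invertible (Lambda_ff (csp_Lambda (H \<epsilon>) A\<^sub>0 B\<^sub>0 z))"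
    \<comment> \<open>the CSP manifold of order 0\<close>
    and "local_graph X h\<^sub>0 \<epsilon>\<^sub>0 (\<lambda>\<epsilon>. csp_manifold_0 \<Omega> (H \<epsilon>) A\<^sub>0 B\<^sub>0) \<psi>\<^sub>0"
    and "\<forall>x\<in>X. (\<lambda>\<epsilon>. norm (\<psi>\<^sub>0 x \<epsilon> - h\<^sub>0 x)) \<in> O[at_right 0](\<lambda>\<epsilon>. \<epsilon>)"
    \<comment> \<open>the CSP manifold of order 1\<close>
    and "local_graph X h\<^sub>0 \<epsilon>\<^sub>0
           (\<lambda>\<epsilon>. csp_manifold_Suc \<Omega> X (H \<epsilon>) A\<^sub>0 B\<^sub>0 0 (\<lambda>x. \<psi>\<^sub>0 x \<epsilon>)) \<psi>\<^sub>1"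
    and "\<forall>x\<in>X. (\<lambda>\<epsilon>. norm (\<psi>\<^sub>1 x \<epsilon> - (h\<^sub>0 x + \<epsilon> *\<^sub>R \<psi>\<^sub>1\<^sub>1 x))) \<in> O[at_right 0](\<lambda>\<epsilon>. \<epsilon>\<^sup>2)"
  shows "\<forall>x\<in>X. \<psi>\<^sub>1\<^sub>1 x =
           - (matrix_inv (jacobian (\<lambda>y. f (zjoin x y)) (at (h\<^sub>0 x))) *v
                (matrix_inv (jacobian f (at (zjoin x (h\<^sub>0 x))) ** N (zjoin x (h\<^sub>0 x))) *v
                  (jacobian f (at (zjoin x (h\<^sub>0 x))) *v G (zjoin x (h\<^sub>0 x)) 0)))"
proof
  note N = assms(5) and f = assms(6) and G = assms(7) and \<Omega> = assms(11) and S = assms(12)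
    and inv_y = assms(13) and P = assms(14) and Q = assms(15) and perp = assms(16)
    and inv_fN = assms(18) and inv_QP = assms(19)
    and order_0 = assms(22) and graph_1 = assms(23) and order_1 = assms(24)
  fix x assume x: "x \<in> X"
  define z\<^sub>0 where "z\<^sub>0 = zjoin x (h\<^sub>0 x)"
  define D where "D = jacobian f (at z\<^sub>0)"
  define Y where "Y = jacobian (\<lambda>y. f (zjoin x y)) (at (h\<^sub>0 x))"
  define C where "C = matrix_inv (D ** N z\<^sub>0)"
  have "z\<^sub>0 \<in> {z. f z = 0} \<inter> \<Omega>"
    using x unfolding S graph_over_def z\<^sub>0_def by blast
  then have z\<^sub>0: "z\<^sub>0 \<in> \<Omega>" and f0: "f z\<^sub>0 = 0" by auto
  have C: "C ** (D ** N z\<^sub>0) = mat 1"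
    using inv_fN z\<^sub>0 by (simp add: C_def D_def matrix_inv_inverse)

  have "((\<lambda>\<epsilon>. \<psi>\<^sub>0 x \<epsilon>) \<longlongrightarrow> h\<^sub>0 x) (at_right 0)"
    using order_0 x by (intro tendsto_of_bigo_ident) simp
  then have z_0: "((\<lambda>\<epsilon>. zjoin x (\<psi>\<^sub>0 x \<epsilon>)) \<longlongrightarrow> z\<^sub>0) (at_right 0)"
    unfolding z\<^sub>0_def by (rule tendsto_zjoin)
  have quot: "((\<lambda>\<epsilon>. (\<psi>\<^sub>1 x \<epsilon> - h\<^sub>0 x) /\<^sub>R \<epsilon>) \<longlongrightarrow> \<psi>\<^sub>1\<^sub>1 x) (at_right 0)"
    using order_1 x by (intro difference_quotient_of_bigo_square) simp
  have z_1: "((\<lambda>\<epsilon>. zjoin x (\<psi>\<^sub>1 x \<epsilon>)) \<longlongrightarrow> z\<^sub>0) (at_right 0)"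
    unfolding z\<^sub>0_def by (rule tendsto_zjoin[OF tendsto_of_difference_quotient[OF quot]])

  have "((\<lambda>y. f (zjoin x y)) has_derivative (\<lambda>v. Y *v v)) (at (h\<^sub>0 x))"
  proof -
    from f obtain f' where "(f has_derivative f') (at z\<^sub>0)"
      unfolding C1_on_def by blast
    from diff_chain_at[OF has_derivative_zjoin this[unfolded z\<^sub>0_def]]
    have "(\<lambda>y. f (zjoin x y)) differentiable (at (h\<^sub>0 x))"
      unfolding differentiable_def o_def by blast
    then show ?thesis by (simp add: jacobian_works Y_def)
  qed
  from difference_quotient_tendsto[OF this quot]
  have f_quot: "((\<lambda>\<epsilon>. f (zjoin x (\<psi>\<^sub>1 x \<epsilon>)) /\<^sub>R \<epsilon>) \<longlongrightarrow> Y *v \<psi>\<^sub>1\<^sub>1 x) (at_right 0)"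
    using f0 by (simp add: z\<^sub>0_def)

  let ?Bs = "\<lambda>\<epsilon>. csp_Bs (H \<epsilon>) A\<^sub>0 B\<^sub>0 1 (zjoin x (\<psi>\<^sub>0 x \<epsilon>))"
    and ?w = "\<lambda>\<epsilon>. H \<epsilon> (zjoin x (\<psi>\<^sub>1 x \<epsilon>)) /\<^sub>R \<epsilon>"
  have "(?Bs \<longlongrightarrow> C ** D) (at_right 0)"
    unfolding assms(1-3) C_def D_def
    using perp inv_fN inv_QP z\<^sub>0
    by (intro csp_Bs_1_tendsto[OF N f G eps \<Omega> z\<^sub>0 P Q _ _ _ z_0 tendsto_ident_at f0]) auto
  moreover have "(?w \<longlongrightarrow> N z\<^sub>0 *v (Y *v \<psi>\<^sub>1\<^sub>1 x) + G z\<^sub>0 0) (at_right 0)"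
    unfolding assms(1) by (rule vfield_div_tendsto[OF N f G eps z_1 f_quot])
  ultimately have lim: "((\<lambda>\<epsilon>. ?Bs \<epsilon> *v ?w \<epsilon>) \<longlongrightarrow>
      (C ** D) *v (N z\<^sub>0 *v (Y *v \<psi>\<^sub>1\<^sub>1 x) + G z\<^sub>0 0)) (at_right 0)"
    by (rule tendsto_matrix_vector_mult)
  have "eventually (\<lambda>\<epsilon>. ?Bs \<epsilon> *v ?w \<epsilon> = 0) (at_right 0)"
    using eventually_at_right_real[OF eps]
    by eventually_elim
      (use csp_Bs_1_vfield_on_graph[OF graph_1 x] in \<open>simp add: matrix_vector_mult_scaleR\<close>)
  then have "(C ** D) *v (N z\<^sub>0 *v (Y *v \<psi>\<^sub>1\<^sub>1 x) + G z\<^sub>0 0) = 0"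
    by (intro tendsto_unique[OF trivial_limit_at_right_real lim] tendsto_eventually)
  moreover have "(C ** D) *v (N z\<^sub>0 *v (Y *v \<psi>\<^sub>1\<^sub>1 x) + G z\<^sub>0 0)
      = (C ** (D ** N z\<^sub>0)) *v (Y *v \<psi>\<^sub>1\<^sub>1 x) + C *v (D *v G z\<^sub>0 0)"
    by (simp add: matrix_vector_right_distrib matrix_vector_mul_assoc matrix_mul_assoc)
  ultimately have "Y *v \<psi>\<^sub>1\<^sub>1 x = - (C *v (D *v G z\<^sub>0 0))"
    by (simp add: C eq_neg_iff_add_eq_0)
  then have "matrix_inv Y *v (Y *v \<psi>\<^sub>1\<^sub>1 x) = - (matrix_inv Y *v (C *v (D *v G z\<^sub>0 0)))"
    by (simp add: bounded_bilinear.minus_right[OF bounded_bilinear_matrix_vector_mult])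
  moreover have "matrix_inv Y *v (Y *v \<psi>\<^sub>1\<^sub>1 x) = \<psi>\<^sub>1\<^sub>1 x"
    using inv_y x by (simp add: Y_def matrix_vector_mul_assoc matrix_inv_inverse(2))
  ultimately show "\<psi>\<^sub>1\<^sub>1 x =
           - (matrix_inv (jacobian (\<lambda>y. f (zjoin x y)) (at (h\<^sub>0 x))) *v
                (matrix_inv (jacobian f (at (zjoin x (h\<^sub>0 x))) ** N (zjoin x (h\<^sub>0 x))) *v
                  (jacobian f (at (zjoin x (h\<^sub>0 x))) *v G (zjoin x (h\<^sub>0 x)) 0)))"
    by (simp add: Y_def C_def D_def z\<^sub>0_def)
qed

end
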